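(* The number of $4\times 4$ Hadamard matrices $\mathrm{Hada}(a_1,a_2,a_3,a_4)$ over $\mathbb{F}_{2^r}$, with exactly one of $a_1,a_2,a_3,a_4$ equal to $0$, that are NMDS matrices is $$4(2^r-1)(2^{2r}-3\cdot 2^r+3).$$
   Context: For $a_1,a_2,a_3,a_4\in\mathbb{F}_{2^r}$, $\mathrm{Hada}(a_1,a_2,a_3,a_4)$ denotes the (finite field) Hadamard matrix $$\begin{bmatrix} a_1&a_2&a_3&a_4\\ a_2&a_1&a_4&a_3\\ a_3&a_4&a_1&a_2\\ a_4&a_3&a_2&a_1\end{bmatrix}.$$ An $[m,k]$ linear code is Near-MDS (NMDS) if its minimum distance is $m-k$ and its dual $[m,m-k]$ code has minimum distance $k$. A matrix $M$ of order $N$ is an NMDS matrix if $[I_N\,|\,M]$ is a generator matrix of a $[2N,N]$ NMDS code (i.e. the code and its dual both have minimum distance $N$). *)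

theory Defs
  imports "HOL-Analysis.Cartesian_Space"
begin

text \<open>Codes of length \<open>CARD('n)\<close> over a finite field \<open>'a\<close> are sets of vectors of type \<open>'a^'n\<close>.\<close>

definition linear_code :: "('a::field ^ 'n) set \<Rightarrow> nat \<Rightarrow> bool"
  where "linear_code C k \<longleftrightarrow> vec.subspace C \<and> vec.dim C = k"

definition hamming_dist :: "'a ^ 'n \<Rightarrow> 'a ^ 'n \<Rightarrow> nat"
  where "hamming_dist x y = card {i. x $ i \<noteq> y $ i}"

text \<open>The infimum is an attained minimum whenever \<open>C\<close> has two distinct codewords; for a
  code with fewer codewords it is \<open>0\<close> by the library convention for the empty set.\<close>

definition min_distance :: "('a ^ 'n) set \<Rightarrow> nat"
  where "min_distance C = Inf {hamming_dist x y | x y. x \<in> C \<and> y \<in> C \<and> x \<noteq> y}"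

definition dual_code :: "('a::field ^ 'n) set \<Rightarrow> ('a ^ 'n) set"
  where "dual_code C = {y. \<forall>x\<in>C. (\<Sum>i\<in>UNIV. x $ i * y $ i) = 0}"

text \<open>No truncation occurs in \<open>CARD('n) - k\<close>, because the dimension \<open>k\<close> is at most \<open>CARD('n)\<close>.\<close>

definition nmds_code :: "('a::field ^ 'n) set \<Rightarrow> nat \<Rightarrow> bool"
  where "nmds_code C k \<longleftrightarrow>
    linear_code C k \<and> min_distance C = CARD('n) - k \<and>
    linear_code (dual_code C) (CARD('n) - k) \<and> min_distance (dual_code C) = k"

text \<open>The dimension condition makes the \<open>CARD('k)\<close> rows a basis rather than just a spanning set.\<close>

definition generator_matrix :: "'a::field ^ 'n ^ 'k \<Rightarrow> ('a ^ 'n) set \<Rightarrow> bool"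
  where "generator_matrix G C \<longleftrightarrow> vec.span (rows G) = C \<and> linear_code C (CARD('k))"

text \<open>The block matrix \<open>[A | B]\<close>: the columns are indexed by the disjoint sum of the
  two column index types.\<close>

definition append_columns :: "'a ^ 'm ^ 'k \<Rightarrow> 'a ^ 'n ^ 'k \<Rightarrow> 'a ^ ('m + 'n) ^ 'k"
  where "append_columns A B =
    (\<chi> i j. case j of Inl j1 \<Rightarrow> A $ i $ j1 | Inr j2 \<Rightarrow> B $ i $ j2)"

definition nmds_matrix :: "'a::field ^ 'n ^ 'n \<Rightarrow> bool"
  where "nmds_matrix M \<longleftrightarrow>
    (\<exists>C. generator_matrix (append_columns (mat 1) M) C \<and> nmds_code C (CARD('n)))"

definition hada :: "'a::zero \<Rightarrow> 'a \<Rightarrow> 'a \<Rightarrow> 'a \<Rightarrow> 'a ^ 4 ^ 4"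
  where "hada a1 a2 a3 a4 =
    vector [vector [a1, a2, a3, a4],
            vector [a2, a1, a4, a3],
            vector [a3, a4, a1, a2],
            vector [a4, a3, a2, a1]]"

end

theory Submission
  imports Defs
begin

text \<open>Let \<open>M = hada a1 a2 a3 a4\<close> with exactly one zero parameter and put \<open>s = a1 + a2 + a3 + a4\<close>.
  Since \<open>M\<close> is symmetric and the characteristic is 2, the dual of the code \<open>{(x, xM)}\<close> is
  \<open>{(yM, y)}\<close>, so the two minimum distances agree and only codeword weights matter.
  Every row of \<open>M\<close> has weight 3, and \<open>M\<^sup>2 = s\<^sup>2 I\<close>. If \<open>s = 0\<close>, a row \<open>v\<close> of \<open>M\<close> gives the codeword
  \<open>(v, 0)\<close> of weight 3. If \<open>s \<noteq> 0\<close>, then \<open>x\<close> and \<open>xM\<close> determine each other up to the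
  scalar \<open>s\<^sup>2\<close>: if one of them has weight 1, the other has weight 3; otherwise
  both have weight at least 2. Hence \<open>M\<close> is NMDS iff \<open>s \<noteq> 0\<close>, and it remains to count triples of
  nonzero elements with nonzero sum.\<close>

section \<open>Codes with a systematic generator matrix\<close>

definition hamming_weight :: "'a::zero ^ 'n \<Rightarrow> nat"
  where "hamming_weight x = card {i. x $ i \<noteq> 0}"

definition join_vec :: "'a ^ 'm \<Rightarrow> 'a ^ 'n \<Rightarrow> 'a ^ ('m + 'n)"
  where "join_vec x y = (\<chi> j. case j of Inl i \<Rightarrow> x $ i | Inr i \<Rightarrow> y $ i)"

lemma join_vec_nth [simp]:
  "join_vec x y $ Inl i = x $ i" "join_vec x y $ Inr j = y $ j"
  by (simp_all add: join_vec_def)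

lemma all_sum_type: "(\<forall>i :: 'm + 'n. P i) \<longleftrightarrow> (\<forall>i. P (Inl i)) \<and> (\<forall>j. P (Inr j))"
  by (metis obj_sumE)

lemma join_vec_eq_iff: "z = join_vec x y \<longleftrightarrow> (\<forall>i. z $ Inl i = x $ i) \<and> (\<forall>j. z $ Inr j = y $ j)"
  by (simp add: vec_eq_iff all_sum_type)

lemma sum_UNIV_Plus:
  fixes f :: "'m::finite + 'n::finite \<Rightarrow> 'b::comm_monoid_add"
  shows "sum f UNIV = (\<Sum>i\<in>UNIV. f (Inl i)) + (\<Sum>j\<in>UNIV. f (Inr j))"
  by (simp add: UNIV_Plus_UNIV[symmetric] sum.Plus del: UNIV_Plus_UNIV)

lemma hamming_weight_eq_sum:
  "hamming_weight (x :: 'a::zero ^ 'n) = (\<Sum>i\<in>UNIV. of_bool (x $ i \<noteq> 0))"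
  by (simp add: hamming_weight_def sum_of_bool_eq)

lemma hamming_weight_join_vec:
  "hamming_weight (join_vec x y) = hamming_weight x + hamming_weight y"
  by (simp add: hamming_weight_eq_sum sum_UNIV_Plus)

lemma hamming_weight_eq_0_iff [simp]: "hamming_weight (x :: 'a::zero ^ 'n) = 0 \<longleftrightarrow> x = 0"
  by (auto simp: hamming_weight_def vec_eq_iff)

lemma hamming_weight_smult [simp]:
  "c \<noteq> 0 \<Longrightarrow> hamming_weight (c *s x) = hamming_weight (x :: 'a::field ^ 'n)"
  by (simp add: hamming_weight_def)

lemma hamming_dist_eq_weight:
  "hamming_dist x y = hamming_weight (x - y :: 'a::ab_group_add ^ 'n)"
  by (simp add: hamming_dist_def hamming_weight_def)

lemma hamming_weight_1E:
  assumes "hamming_weight (x :: 'a::field ^ 'n) = 1"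
  obtains c i where "c \<noteq> 0" "x = c *s axis i 1"
proof -
  obtain i where i: "{i. x $ i \<noteq> 0} = {i}"
    using assms unfolding hamming_weight_def by (rule card_1_singletonE)
  then have "x $ i \<noteq> 0" "x = (x $ i) *s axis i 1"
    by (auto simp: vec_eq_iff axis_def)
  then show thesis by (rule that)
qed

section \<open>Row spaces and images of injective linear maps as codes\<close>

lemma axis_vector_matrix_mult: "axis i 1 v* (M :: 'a::comm_semiring_1 ^ 'n ^ 'm) = M $ i"
  by (simp add: vector_matrix_mult_def axis_def vec_eq_iff if_distrib if_distribR cong: if_cong)

lemma linear_vector_matrix_mult:
  "Vector_Spaces.linear (*s) (*s) (\<lambda>x. x v* (G :: 'a::field ^ 'n ^ 'm))"
proof -
  have "(\<lambda>x. x v* G) = (*v) (transpose G)"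
    by (simp add: fun_eq_iff)
  then show ?thesis by simp
qed

lemma span_rows_eq_range: "vec.span (rows (G :: 'a::field ^ 'n ^ 'm)) = range (\<lambda>x. x v* G)"
proof -
  have "rows G = (\<lambda>x. x v* G) ` cart_basis"
    by (simp add: rows_def row_def cart_basis_def full_SetCompr_eq image_image
        axis_vector_matrix_mult)
  then show ?thesis
    using vec.linear_span_image[OF linear_vector_matrix_mult, of G cart_basis] by simp
qed

lemma linear_code_range:
  fixes f :: "'a::field ^ 'n \<Rightarrow> 'a ^ 'm"
  assumes "Vector_Spaces.linear (*s) (*s) f" "inj f"
  shows "linear_code (range f) (CARD('n))"
  unfolding linear_code_def
  using assms vec.linear_subspace_image[OF assms(1) vec.subspace_UNIV]
    vec.dim_image_eq[OF assms(1), of UNIV]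
  by (simp add: vec.span_UNIV card_cart_basis vec.dim_UNIV vec.dimension_def)

text \<open>Distances are weights of differences, and by linearity and injectivity the differences
  of distinct codewords are exactly the images of nonzero vectors.\<close>

lemma min_distance_range:
  fixes f :: "'a::field ^ 'n \<Rightarrow> 'a ^ 'm"
  assumes "Vector_Spaces.linear (*s) (*s) f" "inj f"
  shows "min_distance (range f) = Inf {hamming_weight (f x) | x. x \<noteq> 0}"
proof -
  have diff: "f (x - y) = f x - f y" for x y
    by (rule vec.linear_diff[OF assms(1)])
  have "{hamming_dist x y | x y. x \<in> range f \<and> y \<in> range f \<and> x \<noteq> y}
      = {hamming_weight (f (x - y)) | x y. x - y \<noteq> 0}"
    using assms(2) by (fastforce simp: hamming_dist_eq_weight diff inj_eq)
  also have "\<dots> = {hamming_weight (f x) | x. x \<noteq> 0}"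
    by (metis diff_zero)
  finally show ?thesis by (simp add: min_distance_def)
qed

section \<open>Systematic encoders of a code and of its dual\<close>

definition encode :: "'a::field ^ 'n ^ 'm \<Rightarrow> 'a ^ 'm \<Rightarrow> 'a ^ ('m + 'n)"
  where "encode M x = join_vec x (x v* M)"

text \<open>Encoder for the parity-check matrix \<open>[- transpose M | I]\<close>. The sign makes
  duality hold in every characteristic.\<close>

definition dual_encode :: "'a::field ^ 'n ^ 'm \<Rightarrow> 'a ^ 'n \<Rightarrow> 'a ^ ('m + 'n)"
  where "dual_encode M y = join_vec (- (M *v y)) y"

lemma encode_eq: "encode M x = x v* append_columns (mat 1) M"
  using vector_matrix_mul_rid[of x]
  by (simp add: encode_def append_columns_def vec_eq_iff all_sum_type vector_matrix_mult_def)

lemma linear_encode: "Vector_Spaces.linear (*s) (*s) (encode M)"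
  using linear_vector_matrix_mult[of "append_columns (mat 1) M"] by (simp add: encode_eq[abs_def])

lemma inj_encode: "inj (encode M)"
  by (rule injI) (simp add: encode_def vec_eq_iff all_sum_type)

lemma linear_dual_encode: "Vector_Spaces.linear (*s) (*s) (dual_encode M)"
  by (auto simp: Vector_Spaces.linear_iff vec.vector_space_axioms dual_encode_def vec_eq_iff
      all_sum_type vec.add vec.scale)

lemma inj_dual_encode: "inj (dual_encode M)"
  by (rule injI) (simp add: dual_encode_def vec_eq_iff all_sum_type)

text \<open>The inner product of \<open>encode M x\<close> with \<open>z\<close> is that of
  \<open>x\<close> with the left half of \<open>z\<close> plus \<open>M\<close> applied to the right
  half. It vanishes for all \<open>x\<close> only if this sum does.\<close>

lemma dual_code_range_encode: "dual_code (range (encode M)) = range (dual_encode M)"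
proof -
  have inner: "(\<Sum>i\<in>UNIV. encode M x $ i * z $ i) =
      (\<Sum>i\<in>UNIV. x $ i * (z $ Inl i + (M *v (\<chi> j. z $ Inr j)) $ i))" for x z
  proof -
    have "(\<Sum>j\<in>UNIV. (x v* M) $ j * z $ Inr j)
        = (\<Sum>j\<in>UNIV. \<Sum>i\<in>UNIV. x $ i * (M $ i $ j * z $ Inr j))"
      by (simp add: vector_matrix_mult_def sum_distrib_right mult.assoc)
    also have "\<dots> = (\<Sum>i\<in>UNIV. x $ i * (M *v (\<chi> j. z $ Inr j)) $ i)"
      by (subst sum.swap) (simp add: matrix_vector_mult_def sum_distrib_left)
    finally show ?thesis
      by (simp add: encode_def sum_UNIV_Plus sum.distrib distrib_left)
  qed
  show ?thesis
  proof (intro set_eqI iffI)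
    fix z assume z: "z \<in> dual_code (range (encode M))"
    have "z $ Inl i = - (M *v (\<chi> j. z $ Inr j)) $ i" for i
    proof -
      \<comment> \<open>Testing orthogonality against the unit vector \<open>axis i 1\<close>
        isolates coordinate \<open>i\<close>.\<close>
      have "(\<Sum>k\<in>UNIV. axis i 1 $ k * (z $ Inl k + (M *v (\<chi> j. z $ Inr j)) $ k)) = 0"
        using z unfolding dual_code_def inner[symmetric] by blast
      then show ?thesis
        by (simp add: axis_def if_distrib if_distribR eq_neg_iff_add_eq_0 cong: if_cong)
    qed
    then have "z = dual_encode M (\<chi> j. z $ Inr j)"
      by (simp add: dual_encode_def join_vec_eq_iff)
    then show "z \<in> range (dual_encode M)" by blast
  next
    fix z assume "z \<in> range (dual_encode M)"
    then show "z \<in> dual_code (range (encode M))"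
      by (auto simp: dual_code_def inner dual_encode_def)
  qed
qed

text \<open>Under these hypotheses \<open>dual_encode M x\<close> is \<open>encode M x\<close> with
  its halves swapped. Length minus dimension equals the dimension, so both distance conditions
  become one.\<close>

lemma nmds_matrix_symmetric_iff:
  fixes M :: "'a::field ^ 'n ^ 'n"
  assumes "transpose M = M" and two: "(2 :: 'a) = 0"
  shows "nmds_matrix M \<longleftrightarrow>
    Inf {hamming_weight x + hamming_weight (x v* M) | x. x \<noteq> 0} = CARD('n)"
proof -
  have neg: "- y = y" for y :: "'a ^ 'n"
  proof -
    have "- c = c" for c :: 'a
      using two by (metis mult_2 mult_zero_left neg_eq_iff_add_eq_0)
    then show ?thesis by (simp add: vec_eq_iff)
  qed
  have sym: "M *v y = y v* M" for y
    by (metis assms(1) transpose_matrix_vector)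
  have w: "hamming_weight (encode M x) = hamming_weight x + hamming_weight (x v* M)"
    "hamming_weight (dual_encode M x) = hamming_weight x + hamming_weight (x v* M)" for x
    by (simp_all add: encode_def dual_encode_def hamming_weight_join_vec neg sym)
  have gen: "generator_matrix (append_columns (mat 1) M) C \<longleftrightarrow> C = range (encode M)" for C
    using linear_code_range[OF linear_encode inj_encode, of M]
    by (auto simp: generator_matrix_def span_rows_eq_range encode_eq)
  show ?thesis
    unfolding nmds_matrix_def nmds_code_def gen
    using linear_code_range[OF linear_encode inj_encode, of M]
      linear_code_range[OF linear_dual_encode inj_dual_encode, of M]
    by (simp add: dual_code_range_encode min_distance_range linear_encode inj_encode
        linear_dual_encode inj_dual_encode w)
qed

section \<open>The NMDS criterion for Hadamard matrices\<close>

lemma vector_4: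
  "(vector [a, b, c, d] :: 'a::zero ^ 4) $ 1 = a"
  "(vector [a, b, c, d] :: 'a::zero ^ 4) $ 2 = b"
  "(vector [a, b, c, d] :: 'a::zero ^ 4) $ 3 = c"
  "(vector [a, b, c, d] :: 'a::zero ^ 4) $ 4 = d"
  by (simp_all add: vector_def)

lemma hada_nth:
  "hada a b c d $ 1 = vector [a, b, c, d]"
  "hada a b c d $ 2 = vector [b, a, d, c]"
  "hada a b c d $ 3 = vector [c, d, a, b]"
  "hada a b c d $ 4 = vector [d, c, b, a]"
  by (simp_all add: hada_def vector_def)

lemma hada_eq_iff: "hada a b c d = hada a' b' c' d' \<longleftrightarrow> a = a' \<and> b = b' \<and> c = c' \<and> d = d'"
  by (auto simp: vec_eq_iff forall_4 hada_nth vector_4)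

lemma transpose_hada: "transpose (hada a b c d) = hada a b c d"
  by (simp add: vec_eq_iff transpose_def forall_4 hada_nth vector_4)

lemma hamming_weight_hada_row:
  assumes "count_list [a, b, c, d] 0 = 1"
  shows "hamming_weight (hada a b c d $ i) = 3"
proof -
  have "\<forall>i. hamming_weight (hada a b c d $ i) = 3"
    using assms by (simp add: forall_4 hada_nth vector_4 hamming_weight_eq_sum sum_4 split: if_splits)
  then show ?thesis ..
qed

text \<open>A diagonal entry is the sum of the four squares, which is the square of the sum in
  characteristic 2. Off the diagonal every product occurs twice.\<close>

lemma hada_square:
  fixes a b c d :: "'a::field"
  assumes two: "(2 :: 'a) = 0"
  shows "hada a b c d ** hada a b c d = mat ((a + b + c + d)\<^sup>2)"
proof -
  have dbl: "x + x = 0" "x + (x + y) = y" for x y :: 'a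
    using two by (metis mult_2 mult_zero_left, metis add.assoc add_0 mult_2 mult_zero_left)
  show ?thesis
    by (simp add: vec_eq_iff forall_4 matrix_matrix_mult_def sum_4 hada_nth vector_4 mat_def
        power2_eq_square algebra_simps dbl)
qed

lemma nmds_matrix_hada_iff:
  fixes a b c d :: "'a::field"
  assumes two: "(2 :: 'a) = 0" and zero: "count_list [a, b, c, d] 0 = 1"
  shows "nmds_matrix (hada a b c d) \<longleftrightarrow> a + b + c + d \<noteq> 0"
proof -
  define M where "M = hada a b c d"
  \<comment> \<open>This \<open>s\<close> is the square of the parameter sum, hence the scalar by
    which \<open>M ** M\<close> acts; it vanishes exactly when the sum does.\<close>
  define s where "s = (a + b + c + d)\<^sup>2"
  define W where "W = {hamming_weight x + hamming_weight (x v* M) | x. x \<noteq> 0}"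
  have sq: "(x v* M) v* M = s *s x" for x
  proof -
    have "(x v* M) v* M = x v* mat s"
      by (simp add: vector_matrix_mul_assoc M_def s_def hada_square[OF two])
    also have "\<dots> = s *s x"
      by (simp add: vec_eq_iff vector_matrix_mult_def mat_def if_distrib if_distribR mult.commute
          cong: if_cong)
    finally show ?thesis .
  qed
  have wt1: "hamming_weight (x v* M) = 3" if x: "hamming_weight x = 1" for x
  proof -
    obtain c i where "c \<noteq> 0" "x = c *s axis i 1"
      using x by (rule hamming_weight_1E)
    then show ?thesis
      by (simp add: axis_vector_matrix_mult scalar_vector_matrix_assoc M_def
          hamming_weight_hada_row[OF zero])
  qed
  have "Inf W = 4 \<longleftrightarrow> a + b + c + d \<noteq> 0"
  proof (cases "s = 0")
    case True
    have "hamming_weight (M $ 1) = 3"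
      by (simp add: M_def hamming_weight_hada_row[OF zero])
    moreover have "M $ 1 v* M = 0"
      \<comment> \<open>The first row is itself the image of a unit vector, so a second application
        of \<open>M\<close> multiplies that vector by \<open>s = 0\<close>.\<close>
      using sq[of "axis 1 1"] True by (simp add: axis_vector_matrix_mult)
    moreover from calculation(1) have "M $ 1 \<noteq> 0"
      by (metis hamming_weight_eq_0_iff zero_neq_numeral)
    ultimately have "3 \<in> W"
      unfolding W_def by (intro CollectI exI[of _ "M $ 1"]) simp
    then have "Inf W \<le> 3"
      by (rule wellorder_Inf_le1)
    then show ?thesis
      using True by (simp add: s_def)
  next
    case False
    have "4 \<le> hamming_weight x + hamming_weight (x v* M)" if "x \<noteq> 0" for x
    proof -
      let ?y = "x v* M"
      have "?y \<noteq> 0"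
        using sq[of x] False that by auto
      then have pos: "hamming_weight x \<noteq> 0" "hamming_weight ?y \<noteq> 0"
        using that by simp_all
      \<comment> \<open>Here \<open>wt1\<close> is applied to \<open>?y\<close>: its image is
        \<open>s *s x\<close>, which has the weight of \<open>x\<close> because \<open>s\<close> is
        nonzero.\<close>
      have "hamming_weight x = 3" if "hamming_weight ?y = 1"
        using wt1[OF that] False by (simp add: sq)
      with pos wt1[of x] show ?thesis by linarith
    qed
    moreover have "4 \<in> W"
    proof -
      have "hamming_weight (axis 1 1 :: 'a ^ 4) = 1"
        by (simp add: hamming_weight_def axis_def)
      moreover from this have "(axis 1 1 :: 'a ^ 4) \<noteq> 0"
        by (metis hamming_weight_eq_0_iff zero_neq_one)
      ultimately show ?thesis
        unfolding W_def using wt1 by (intro CollectI exI[of _ "axis 1 1"]) simp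
    qed
    ultimately have "Inf W = 4"
      by (intro cInf_eq_minimum) (auto simp: W_def)
    then show ?thesis
      using False by (simp add: s_def)
  qed
  then show ?thesis
    using nmds_matrix_symmetric_iff[OF transpose_hada two, of a b c d]
    by (simp add: M_def W_def)
qed

section \<open>Counting\<close>

text \<open>Translation by 1 permutes the ring, so adding 1 to every element leaves the sum of all
  elements unchanged.\<close>

lemma of_nat_CARD_eq_0: "of_nat CARD('a::{ring_1, finite}) = (0 :: 'a)"
proof -
  have "(\<Sum>x\<in>UNIV. x + 1 :: 'a) = (\<Sum>x\<in>UNIV. x)"
    by (rule sum.reindex_bij_witness[of _ "\<lambda>x. x - 1" "\<lambda>x. x + 1"]) auto
  then show ?thesis by (simp add: sum.distrib)
qed

text \<open>With \<open>n\<close> nonzero elements, \<open>n^2 - n\<close> pairs have nonzero sum.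
  Each extends uniquely to a nonzero triple of sum zero, which leaves \<open>n^3 - (n^2 - n)\<close>
  triples.\<close>

lemma card_nonzero_triples_nonzero_sum:
  "int (card {(x, y, z) | x y z :: 'a::{field, finite}. x \<noteq> 0 \<and> y \<noteq> 0 \<and> z \<noteq> 0 \<and> x + y + z \<noteq> 0})
    = (int CARD('a) - 1) * ((int CARD('a))\<^sup>2 - 3 * int CARD('a) + 3)"
proof -
  define N :: "'a set" where "N = UNIV - {0}"
  define Y where "Y = {(x, y). x \<in> N \<and> y \<in> N \<and> x + y \<noteq> 0}"
  define B where "B = {(x, y, z). x \<in> N \<and> y \<in> N \<and> z \<in> N \<and> x + y + z \<noteq> 0}"
  have cN: "int (card N) = int CARD('a) - 1"
    by (simp add: N_def card_Diff_singleton of_nat_diff Suc_leI)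
  have "N \<times> N = Y \<union> (\<lambda>x. (x, - x)) ` N"
    by (auto simp: Y_def N_def image_iff add_eq_0_iff)
  then have "card (N \<times> N) = card Y + card ((\<lambda>x. (x, - x)) ` N)"
    by (simp only:) (rule card_Un_disjoint, auto simp: Y_def)
  then have cY: "card N * card N = card Y + card N"
    by (simp add: card_image inj_on_def)
  \<comment> \<open>The third entry of a zero-sum triple is forced, and it is nonzero exactly when
    the first two do not cancel.\<close>
  have Z: "z \<noteq> 0 \<and> x + y + z = 0 \<longleftrightarrow> x + y \<noteq> 0 \<and> z = - (x + y)" for x y z :: 'a
    by (metis add_eq_0_iff neg_0_equal_iff_equal)
  have "N \<times> N \<times> N = B \<union> {(x, y, z). x \<in> N \<and> y \<in> N \<and> z \<noteq> 0 \<and> x + y + z = 0}"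
    by (auto simp: B_def N_def)
  also have "{(x, y, z). x \<in> N \<and> y \<in> N \<and> z \<noteq> 0 \<and> x + y + z = 0}
      = (\<lambda>(x, y). (x, y, - (x + y))) ` Y"
    unfolding Z by (auto simp: Y_def image_iff)
  finally have "N \<times> N \<times> N = B \<union> (\<lambda>(x, y). (x, y, - (x + y))) ` Y" .
  then have "card (N \<times> N \<times> N) = card B + card ((\<lambda>(x, y). (x, y, - (x + y))) ` Y)"
    by (simp only:) (rule card_Un_disjoint, auto simp: B_def)
  then have cB: "card N * (card N * card N) = card B + card Y"
    by (simp add: card_image inj_on_def split_def prod_eq_iff)
  have "int (card B) = int (card N) * (int (card N) * int (card N)) - int (card Y)"
    using cB by (metis add_diff_cancel_right' of_nat_add of_nat_mult)
  moreover have "int (card Y) = int (card N) * int (card N) - int (card N)"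
    using cY by (metis add_diff_cancel_right' of_nat_add of_nat_mult)
  ultimately have "int (card B) = (int CARD('a) - 1) * ((int CARD('a))\<^sup>2 - 3 * int CARD('a) + 3)"
    by (simp add: cN power2_eq_square algebra_simps)
  moreover have "B = {(x, y, z) | x y z. x \<noteq> 0 \<and> y \<noteq> 0 \<and> z \<noteq> 0 \<and> x + y + z \<noteq> 0}"
    by (auto simp: B_def N_def)
  ultimately show ?thesis by simp
qed

text \<open>Inserting a 0 keeps the sum. The four positions give disjoint copies of the triple set,
  since the entries of a triple are nonzero.\<close>

lemma card_quadruples_one_zero:
  shows "card {(a, b, c, d) | a b c d :: 'a::{field, finite}. count_list [a, b, c, d] 0 = 1 \<and> a + b + c + d \<noteq> 0}
    = 4 * card {(x, y, z) | x y z :: 'a. x \<noteq> 0 \<and> y \<noteq> 0 \<and> z \<noteq> 0 \<and> x + y + z \<noteq> 0}"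
    (is "card ?S = 4 * card ?B")
proof -
  define B where "B = ?B"
  have B: "(x, y, z) \<in> B \<longleftrightarrow> x \<noteq> 0 \<and> y \<noteq> 0 \<and> z \<noteq> 0 \<and> x + y + z \<noteq> 0" for x y z
    by (simp add: B_def)
  define f1 f2 f3 f4 where f: "f1 = (\<lambda>(x, y, z). (0 :: 'a, x :: 'a, y :: 'a, z :: 'a))"
    "f2 = (\<lambda>(x, y, z). (x :: 'a, 0 :: 'a, y :: 'a, z :: 'a))"
    "f3 = (\<lambda>(x, y, z). (x :: 'a, y :: 'a, 0 :: 'a, z :: 'a))"
    "f4 = (\<lambda>(x, y, z). (x :: 'a, y :: 'a, z :: 'a, 0 :: 'a))"
  have mem: "(a, b, c, d) \<in> f1 ` B \<longleftrightarrow> a = 0 \<and> (b, c, d) \<in> B"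
    "(a, b, c, d) \<in> f2 ` B \<longleftrightarrow> b = 0 \<and> (a, c, d) \<in> B"
    "(a, b, c, d) \<in> f3 ` B \<longleftrightarrow> c = 0 \<and> (a, b, d) \<in> B"
    "(a, b, c, d) \<in> f4 ` B \<longleftrightarrow> d = 0 \<and> (a, b, c) \<in> B" for a b c d
    by (force simp: f image_iff)+
  have card_f: "card (f1 ` B) = card B" "card (f2 ` B) = card B" "card (f3 ` B) = card B"
    "card (f4 ` B) = card B"
    by (auto simp: f inj_on_def intro!: card_image)
  have "p \<in> ?S \<longleftrightarrow> p \<in> f1 ` B \<union> (f2 ` B \<union> (f3 ` B \<union> f4 ` B))" for p
    by (cases p) (simp add: mem B)
  then have "?S = f1 ` B \<union> (f2 ` B \<union> (f3 ` B \<union> f4 ` B))"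
    by blast
  moreover have "f3 ` B \<inter> f4 ` B = {}" "f2 ` B \<inter> (f3 ` B \<union> f4 ` B) = {}"
    "f1 ` B \<inter> (f2 ` B \<union> (f3 ` B \<union> f4 ` B)) = {}"
    by (auto simp: set_eq_iff mem B)
  ultimately have "card ?S = 4 * card B"
    by (simp only: card_Un_disjoint finite card_f)
  then show ?thesis by (simp only: B_def)
qed

theorem corollary3:
  fixes r :: nat
  assumes "CARD('a::{field, finite}) = 2 ^ r"
  shows "int (card {hada a1 a2 a3 a4 | a1 a2 a3 a4 :: 'a.
            count_list [a1, a2, a3, a4] 0 = 1 \<and> nmds_matrix (hada a1 a2 a3 a4)})
         = 4 * (2 ^ r - 1) * (2 ^ (2 * r) - 3 * 2 ^ r + 3)"
proof -
  \<comment> \<open>The characteristic is read off from the cardinality; a field has no nilpotents,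
    so 2 itself vanishes.\<close>
  have "(2 :: 'a) ^ r = 0"
    using of_nat_CARD_eq_0[where 'a = 'a] by (simp add: assms)
  then have two: "(2 :: 'a) = 0"
    by simp
  let ?S = "{(a, b, c, d) | a b c d :: 'a. count_list [a, b, c, d] 0 = 1 \<and> a + b + c + d \<noteq> 0}"
  let ?h = "\<lambda>(a, b, c, d). hada a b c (d :: 'a)"
  have "{hada a1 a2 a3 a4 | a1 a2 a3 a4 :: 'a.
      count_list [a1, a2, a3, a4] 0 = 1 \<and> nmds_matrix (hada a1 a2 a3 a4)}
    = {hada a1 a2 a3 a4 | a1 a2 a3 a4 :: 'a.
      count_list [a1, a2, a3, a4] 0 = 1 \<and> a1 + a2 + a3 + a4 \<noteq> 0}"
    by (simp only: nmds_matrix_hada_iff[OF two] cong: conj_cong)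
  \<comment> \<open>A Hadamard matrix determines its parameters, so counting matrices amounts to
    counting quadruples.\<close>
  also have "\<dots> = ?h ` ?S"
    by (auto simp del: count_list.simps simp: image_iff hada_eq_iff)
  finally have "card {hada a1 a2 a3 a4 | a1 a2 a3 a4 :: 'a.
      count_list [a1, a2, a3, a4] 0 = 1 \<and> nmds_matrix (hada a1 a2 a3 a4)} = card ?S"
    by (simp only:) (rule card_image, auto simp: inj_on_def hada_eq_iff)
  then have "int (card {hada a1 a2 a3 a4 | a1 a2 a3 a4 :: 'a.
      count_list [a1, a2, a3, a4] 0 = 1 \<and> nmds_matrix (hada a1 a2 a3 a4)})
    = 4 * ((int CARD('a) - 1) * ((int CARD('a))\<^sup>2 - 3 * int CARD('a) + 3))"
    by (simp only: card_quadruples_one_zero card_nonzero_triples_nonzero_sum of_nat_mult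
        of_nat_numeral)
  moreover have "(2 :: int) ^ (2 * r) = (2 ^ r)\<^sup>2"
    by (simp add: power_mult[symmetric] mult.commute)
  ultimately show ?thesis
    by (simp only: assms of_nat_power of_nat_numeral mult.assoc)
qed

end
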